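(* Consider the heterogeneous data-center right-sizing problem with time-independent operating cost functions, i.e. $f_{t,j}=f_j$ for all $t\in[T]$, $j\in[d]$, where $f_j(0)>0$ for all $j$. Then the online algorithm $\mathcal{A}$ described below is $(2d+1)$-competitive: for every such instance, $C(X^{\mathcal A})\le (2d+1)\cdot C(X^\ast)$, where $X^{\mathcal A}$ is the schedule produced by $\mathcal A$ and $X^\ast$ is an optimal schedule.
   Context: Notation: $[k]=\{1,\dots,k\}$, $[k]_0=\{0,\dots,k\}$, $(x)^+=\max(x,0)$. Problem: An instance consists of $T\in\mathbb N$ time slots, $d\in\mathbb N$ server types, numbers $m_1,\dots,m_d\in\mathbb N$ of servers of each type, switching costs $\beta_j>0$, capacities $z^{\max}_j>0$, job volumes $\lambda_t\ge 0$ ($t\in[T]$), and operating cost functions $f_{t,j}$ ($t\in[T]$, $j\in[d]$) that are convex, increasing and non-negative on $[0,z^{\max}_j]$ (taking the value $+\infty$ for loads above $z^{\max}_j$); $f_{t,j}(z)$ is the cost of one server of type $j$ running with load $z$ in slot $t$. For $x\in\mathbb N_0$, $z\in[0,1]$ put $g_{t,j}(x,z)=x f_{t,j}(\lambda_t z/x)$ if $x>0$, $g_{t,j}(0,z)=\infty$ if $\lambda_t z>0$, and $g_{t,j}(0,z)=0$ if $\lambda_t z=0$. Let $\mathcal Z=\{(z_1,\dots,z_d)\in[0,1]^d:\sum_j z_j=1\}$ and $g_t(x_1,\dots,x_d)=\min_{(z_1,\dots,z_d)\in\mathcal Z}\sum_{j=1}^d g_{t,j}(x_j,z_j)$. A schedule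 is $X=(\vec x_1,\dots,\vec x_T)$ with $\vec x_t=(x_{t,1},\dots,x_{t,d})$, $x_{t,j}\in[m_j]_0$, and the convention $\vec x_0=\vec x_{T+1}=\vec 0$; it is feasible if moreover $\sum_j x_{t,j}z^{\max}_j\ge\lambda_t$ for all $t$. Its cost is $C(X)=\sum_{t=1}^T\big(g_t(\vec x_t)+\sum_{j=1}^d\beta_j(x_{t,j}-x_{t-1,j})^+\big)$. An optimal schedule is a feasible schedule of minimum cost. Online setting: $T,d,\vec m,\vec\beta$ are known; at slot $t$ the algorithm learns $\lambda_t$ and $f_{t,1},\dots,f_{t,d}$ and must fix $\vec x_t$ without knowledge of later slots. A deterministic online algorithm is $c$-competitive if on every instance its cost is at most $c$ times the optimal cost. Truncated instances: for $t\in[T]$, $\mathcal I^t$ is the instance with only slots $1,\dots,t$ (same other data, final state $\vec x_{t+1}=\vec 0$); $\hat X^t$ denotes an optimal schedule for $\mathcal I^t$, with entries $\hat x^t_{u,j}$. Algorithm $\mathcal A$ (for $f_{t,j}=f_j$ with $f_j(0)>0$): let $\bar t_j=\lceil\beta_j/f_j(0)\rceil$. Initialize $w_{t,j}=0$ for all $t\in\mathbb Z$, $j\in[d]$, and $x^{\mathcal A}_{0,j}=0$. For $t=1,\dots,T$: compute $\hat X^t$; for each $j\in[d]$ set $x^{\mathcal A}_{t,j}:=x^{\mathcal A}_{t-1,j}-w_{t-\bar t_j,j}$ (the servers powered up at slot $t-\bar t_j$ are powered down); if $x^{\mathcal A}_{t,j}\le\hat x^t_{t,j}$, set $w_{t,j}:=\hat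 x^t_{t,j}-x^{\mathcal A}_{t,j}$ and $x^{\mathcal A}_{t,j}:=\hat x^t_{t,j}$. The output is $X^{\mathcal A}=(\vec x^{\mathcal A}_1,\dots,\vec x^{\mathcal A}_T)$. *)

theory Defs
  imports "HOL-Analysis.Analysis"
begin

text \<open>Time slots are indexed by \<open>1..horizon\<close> and server types by \<open>1..num_types\<close>; values of the
  functions below at other indices are never used.  The cost function \<open>opcost I t j\<close> is only
  meaningful on \<open>[0, zmax I j]\<close>; its extension by infinity is \<open>load_cost\<close>.\<close>

record dc_instance =
  horizon :: nat
  num_types :: nat
  servers :: "nat \<Rightarrow> nat"
  swcost :: "nat \<Rightarrow> real"
  zmax :: "nat \<Rightarrow> real"
  volume :: "nat \<Rightarrow> real"
  opcost :: "nat \<Rightarrow> nat \<Rightarrow> real \<Rightarrow> real"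

type_synonym schedule = "nat \<Rightarrow> nat \<Rightarrow> nat"

definition valid_instance :: "dc_instance \<Rightarrow> bool" where
  "valid_instance I \<longleftrightarrow>
     horizon I \<ge> 1 \<and> num_types I \<ge> 1 \<and>
     (\<forall>j\<in>{1..num_types I}. servers I j \<ge> 1 \<and> swcost I j > 0 \<and> zmax I j > 0) \<and>
     (\<forall>t\<in>{1..horizon I}. volume I t \<ge> 0) \<and>
     (\<forall>t\<in>{1..horizon I}. \<forall>j\<in>{1..num_types I}.
        convex_on {0..zmax I j} (opcost I t j) \<and>
        mono_on {0..zmax I j} (opcost I t j) \<and>
        (\<forall>z\<in>{0..zmax I j}. opcost I t j z \<ge> 0))"

definition load_cost :: "dc_instance \<Rightarrow> nat \<Rightarrow> nat \<Rightarrow> real \<Rightarrow> ereal" where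
  "load_cost I t j z = (if z \<le> zmax I j then ereal (opcost I t j z) else \<infinity>)"

definition type_cost :: "dc_instance \<Rightarrow> nat \<Rightarrow> nat \<Rightarrow> nat \<Rightarrow> real \<Rightarrow> ereal" where
  "type_cost I t j x z =
     (if x > 0 then ereal (real x) * load_cost I t j (volume I t * z / real x)
      else if volume I t * z > 0 then \<infinity> else 0)"

definition load_splits :: "dc_instance \<Rightarrow> (nat \<Rightarrow> real) set" where
  "load_splits I =
     {z. (\<forall>j\<in>{1..num_types I}. z j \<in> {0..1}) \<and> (\<Sum>j=1..num_types I. z j) = 1}"

text \<open>The minimum over all load splits is rendered as an infimum: a convex increasing function on
  \<open>[0, zmax]\<close> may jump upwards at \<open>zmax\<close>, in which case the minimum need not be attained.\<close>

definition slot_cost :: "dc_instance \<Rightarrow> nat \<Rightarrow> (nat \<Rightarrow> nat) \<Rightarrow> ereal" where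
  "slot_cost I t x = (INF z\<in>load_splits I. \<Sum>j=1..num_types I. type_cost I t j (x j) (z j))"

text \<open>The convention that all servers are switched off before the first and after the last slot.\<close>

definition entry :: "dc_instance \<Rightarrow> schedule \<Rightarrow> nat \<Rightarrow> nat \<Rightarrow> nat" where
  "entry I X t j = (if t \<in> {1..horizon I} then X t j else 0)"

definition total_cost :: "dc_instance \<Rightarrow> schedule \<Rightarrow> ereal" where
  "total_cost I X =
     (\<Sum>t=1..horizon I. slot_cost I t (entry I X t) +
        (\<Sum>j=1..num_types I.
           ereal (swcost I j * max (real (entry I X t j) - real (entry I X (t - 1) j)) 0)))"

definition feasible :: "dc_instance \<Rightarrow> schedule \<Rightarrow> bool" where
  "feasible I X \<longleftrightarrow>
     (\<forall>t\<in>{1..horizon I}.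
        (\<forall>j\<in>{1..num_types I}. X t j \<le> servers I j) \<and>
        (\<Sum>j=1..num_types I. real (X t j) * zmax I j) \<ge> volume I t)"

definition optimal :: "dc_instance \<Rightarrow> schedule \<Rightarrow> bool" where
  "optimal I X \<longleftrightarrow> feasible I X \<and> (\<forall>Y. feasible I Y \<longrightarrow> total_cost I X \<le> total_cost I Y)"

definition truncated :: "dc_instance \<Rightarrow> nat \<Rightarrow> dc_instance" where
  "truncated I t = I\<lparr>horizon := t\<rparr>"

definition run_time :: "dc_instance \<Rightarrow> (nat \<Rightarrow> real \<Rightarrow> real) \<Rightarrow> nat \<Rightarrow> nat" where
  "run_time I f j = nat \<lceil>swcost I j / f j 0\<rceil>"

text \<open>State of the algorithm after slot \<open>t\<close>: the current configuration and the array \<open>w\<close> of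
  numbers of servers powered up so far.  \<open>Xh t\<close> is the optimal schedule used for the instance
  truncated after slot \<open>t\<close>.  The subtraction on natural numbers is never truncated,
  see \<open>alg_w_le\<close>.\<close>

primrec alg_state ::
  "dc_instance \<Rightarrow> (nat \<Rightarrow> real \<Rightarrow> real) \<Rightarrow> (nat \<Rightarrow> schedule) \<Rightarrow> nat
     \<Rightarrow> (nat \<Rightarrow> nat) \<times> (int \<Rightarrow> nat \<Rightarrow> nat)" where
  "alg_state I f Xh 0 = ((\<lambda>j. 0), (\<lambda>u j. 0))"
| "alg_state I f Xh (Suc n) =
     (let t = Suc n;
          (x, w) = alg_state I f Xh n;
          y = (\<lambda>j. x j - w (int t - int (run_time I f j)) j);
          xh = Xh t t
      in ((\<lambda>j. if y j \<le> xh j then xh j else y j),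
          w(int t := (\<lambda>j. if y j \<le> xh j then xh j - y j else w (int t) j))))"

definition alg_schedule ::
  "dc_instance \<Rightarrow> (nat \<Rightarrow> real \<Rightarrow> real) \<Rightarrow> (nat \<Rightarrow> schedule) \<Rightarrow> schedule" where
  "alg_schedule I f Xh t = fst (alg_state I f Xh t)"

lemma alg_state_online:
  assumes "\<And>u. u \<in> {1..t} \<Longrightarrow> Xh u u = Xh' u u"
  shows "alg_state I f Xh t = alg_state I f Xh' t"
  using assms
proof (induction t)
  case (Suc n)
  have "alg_state I f Xh n = alg_state I f Xh' n" "Xh (Suc n) (Suc n) = Xh' (Suc n) (Suc n)"
    using Suc by auto
  thus ?case by (simp only: alg_state.simps Let_def)
qed simp

lemma alg_w_outside: "u \<le> 0 \<or> u > int t \<Longrightarrow> snd (alg_state I f Xh t) u j = 0"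
  by (induction t) (auto simp: Let_def split: prod.splits)

lemma alg_x_eq_sum:
  assumes "run_time I f j \<ge> 1"
  shows "fst (alg_state I f Xh t) j
         = (\<Sum>u\<in>{int t - int (run_time I f j)<..int t}. snd (alg_state I f Xh t) u j)"
proof (induction t)
  case 0
  show ?case by simp
next
  case (Suc n)
  define r where "r = int (run_time I f j)"
  have r: "r \<ge> 1" using assms by (simp add: r_def)
  obtain x w where xw: "alg_state I f Xh n = (x, w)" by (cases "alg_state I f Xh n")
  have w0: "w (int n + 1) j = 0"
    using alg_w_outside[of "int n + 1" n I f Xh j] xw by simp
  define S where "S = (\<Sum>u\<in>{int n + 1 - r<..int n}. w u j)"
  have x: "x j = (\<Sum>u\<in>{int n - r<..int n}. w u j)"
    using Suc xw by (simp add: r_def)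
  have "{int n - r<..int n} = insert (int n + 1 - r) {int n + 1 - r<..int n}"
    using r by auto
  hence xS: "x j = w (int n + 1 - r) j + S"
    unfolding x S_def by simp
  define w' where "w' = snd (alg_state I f Xh (Suc n))"
  have w': "w' u j = (if u = int n + 1 then Xh (Suc n) (Suc n) j - S else w u j)" for u
    using xw xS w0 by (auto simp: w'_def Let_def r_def algebra_simps)
  have "{int n + 1 - r<..int n + 1} = insert (int n + 1) {int n + 1 - r<..int n}"
    using r by auto
  hence "(\<Sum>u\<in>{int n + 1 - r<..int n + 1}. w' u j)
         = (Xh (Suc n) (Suc n) j - S) + (\<Sum>u\<in>{int n + 1 - r<..int n}. w' u j)"
    by (simp add: w')
  also have "(\<Sum>u\<in>{int n + 1 - r<..int n}. w' u j) = S"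
    unfolding S_def by (rule sum.cong) (auto simp: w')
  finally have "(\<Sum>u\<in>{int n + 1 - r<..int n + 1}. w' u j) = max (Xh (Suc n) (Suc n) j) S"
    by simp
  moreover have "fst (alg_state I f Xh (Suc n)) j = max (Xh (Suc n) (Suc n) j) S"
    using xw xS by (auto simp: Let_def r_def algebra_simps)
  ultimately show ?case by (simp add: w'_def r_def add.commute)
qed

lemma alg_w_le:
  assumes "run_time I f j \<ge> 1"
  shows "snd (alg_state I f Xh n) (int (Suc n) - int (run_time I f j)) j
         \<le> fst (alg_state I f Xh n) j"
  unfolding alg_x_eq_sum[OF assms]
  by (rule member_le_sum) (use assms in auto)

lemma alg_schedule_feasible:
  assumes "valid_instance I"
    and "\<And>t. t \<in> {1..horizon I} \<Longrightarrow> optimal (truncated I t) (Xh t)"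
  shows "feasible I (alg_schedule I f Xh)"
proof -
  have Xh: "Xh t t j \<le> servers I j" "(\<Sum>j=1..num_types I. real (Xh t t j) * zmax I j) \<ge> volume I t"
    if "t \<in> {1..horizon I}" "j \<in> {1..num_types I}" for t j
    using assms(2)[OF that(1)] that by (auto simp: optimal_def feasible_def truncated_def)
  have ge: "Xh t t j \<le> alg_schedule I f Xh t j" if "t \<ge> 1" for t j
    using that by (cases t) (auto simp: alg_schedule_def Let_def split: prod.splits)
  have le: "t \<le> horizon I \<Longrightarrow> alg_schedule I f Xh t j \<le> servers I j"
    if "j \<in> {1..num_types I}" for t j
  proof (induction t)
    case (Suc n)
    show ?case
      using Suc Xh(1)[of "Suc n" j] that
      by (auto simp: alg_schedule_def Let_def split: prod.splits)
  qed (simp add: alg_schedule_def)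
  have "1 \<in> {1..num_types I}" using assms(1) by (auto simp: valid_instance_def)
  have "(\<Sum>j=1..num_types I. real (alg_schedule I f Xh t j) * zmax I j) \<ge> volume I t"
    if t: "t \<in> {1..horizon I}" for t
  proof -
    have "volume I t \<le> (\<Sum>j=1..num_types I. real (Xh t t j) * zmax I j)"
      using Xh(2)[OF t] \<open>1 \<in> {1..num_types I}\<close> by blast
    also have "\<dots> \<le> (\<Sum>j=1..num_types I. real (alg_schedule I f Xh t j) * zmax I j)"
      using assms(1) t ge
      by (intro sum_mono mult_right_mono) (auto simp: valid_instance_def less_imp_le)
    finally show ?thesis .
  qed
  thus ?thesis using le by (auto simp: feasible_def)
qed

end

theory Submission
  imports Defs
begin

text \<open>Write \<open>OPT n\<close> for the optimal cost of the instance truncated after slot \<open>n\<close>.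
  Cutting an optimal schedule \<open>Xh n\<close> for the slots up to \<open>n\<close> after slot \<open>m\<close> gives a feasible
  schedule for the shorter instance, so \<open>OPT n\<close> is at least \<open>OPT m\<close> plus what \<open>Xh n\<close> pays in the
  slots after \<open>m\<close>.

  For \<open>m = n - 1\<close> this shows that the operating costs of the configurations \<open>Xh t t\<close> sum up to at
  most \<open>OPT T\<close>; by convexity, every additional server of type \<open>j\<close> that the algorithm keeps
  running costs at most \<open>f j 0\<close> per slot.

  For \<open>m = n - r\<close> with \<open>r\<close> the running time of type \<open>j\<close>, each of the \<open>Xh n n j\<close> servers of
  the last slot was either powered up after slot \<open>m\<close> or idled for \<open>r\<close> slots, which costs at least
  \<open>\<beta>\<^sub>j\<close> either way.  If the algorithm powers up servers at slot \<open>n\<close>, then \<open>Xh n n j\<close> is the number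
  of servers it powered up in the last \<open>r\<close> slots; hence \<open>\<beta>\<^sub>j\<close> times the number of all power-ups of
  type \<open>j\<close> is at most \<open>OPT T\<close>.  A power-up causes switching cost \<open>\<beta>\<^sub>j\<close> and idle cost
  \<open>(r - 1) * f j 0 \<le> \<beta>\<^sub>j\<close> besides the slot already accounted for, so each type contributes at
  most \<open>2 * OPT T\<close>.\<close>


section \<open>Inequalities for convex functions and sums\<close>

lemma convex_on_perspective_subadd:
  fixes f :: "'a::real_vector \<Rightarrow> real"
  assumes "convex_on S f" and "u \<in> S" "v \<in> S"
    and "0 \<le> a" "0 \<le> b" and pos: "0 < a + b"
  shows "(a + b) * f ((a *\<^sub>R u + b *\<^sub>R v) /\<^sub>R (a + b)) \<le> a * f u + b * f v"
proof -
  have "a / (a + b) + b / (a + b) = 1"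
    using pos by (simp flip: add_divide_distrib)
  then have "f ((a / (a + b)) *\<^sub>R u + (b / (a + b)) *\<^sub>R v) \<le> a / (a + b) * f u + b / (a + b) * f v"
    using assms unfolding convex_on_def by (meson divide_nonneg_pos)
  moreover have "(a / (a + b)) *\<^sub>R u + (b / (a + b)) *\<^sub>R v = (a *\<^sub>R u + b *\<^sub>R v) /\<^sub>R (a + b)"
    by (simp add: scaleR_add_right divide_inverse mult.commute)
  ultimately have "f ((a *\<^sub>R u + b *\<^sub>R v) /\<^sub>R (a + b)) \<le> (a * f u + b * f v) / (a + b)"
    by (simp add: add_divide_distrib)
  then show ?thesis
    using pos by (simp add: pos_le_divide_eq mult.commute)
qed

lemma diff_le_sum_pos_increments:
  fixes x :: "nat \<Rightarrow> 'a::linordered_idom"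
  assumes "m \<le> n"
  shows "x n - x m \<le> (\<Sum>t=Suc m..n. max (x t - x (t - 1)) 0)"
proof -
  have "x n - x m = (\<Sum>t=Suc m..n. x t - x (t - 1))"
    by (rule sum_telescope''[OF assms, symmetric])
  also have "\<dots> \<le> (\<Sum>t=Suc m..n. max (x t - x (t - 1)) 0)"
    by (intro sum_mono) simp
  finally show ?thesis .
qed

lemma ex_mult_sum_le_weighted_sum:
  fixes x e :: "'a \<Rightarrow> 'b::linordered_idom"
  assumes "finite S" "S \<noteq> {}" and weights_nonneg: "\<And>t. t \<in> S \<Longrightarrow> 0 \<le> e t"
  shows "\<exists>s\<in>S. x s * (\<Sum>t\<in>S. e t) \<le> (\<Sum>t\<in>S. x t * e t)"
proof
  show "arg_min_on x S \<in> S"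
    using assms by (intro arg_min_if_finite)
  have "x (arg_min_on x S) \<le> x t" if "t \<in> S" for t
    using assms that by (intro arg_min_least)
  then show "x (arg_min_on x S) * (\<Sum>t\<in>S. e t) \<le> (\<Sum>t\<in>S. x t * e t)"
    unfolding sum_distrib_left using weights_nonneg by (intro sum_mono mult_right_mono)
qed

text \<open>If \<open>x\<close> is smallest at \<open>s\<close>, then \<open>x s\<close> servers run throughout and the other \<open>x n - x s\<close>
  servers are powered up after \<open>s\<close>.\<close>

lemma power_up_or_run_cost_ge:
  fixes x :: "nat \<Rightarrow> 'a::linordered_idom"
  assumes "m < n" and count_nonneg: "\<And>t. 0 \<le> x t"
    and idle_nonneg: "\<And>t. t \<in> {Suc m..n} \<Longrightarrow> 0 \<le> e t" and "0 \<le> c"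
    and off_or_long_window: "x m = 0 \<or> c \<le> (\<Sum>t=Suc m..n. e t)"
  shows "c * x n \<le> (\<Sum>t=Suc m..n. x t * e t + c * max (x t - x (t - 1)) 0)"
proof -
  let ?rise = "\<lambda>s. \<Sum>t=Suc s..n. max (x t - x (t - 1)) 0"
  obtain s where s: "m \<le> s" "s \<le> n" and run: "c * x s \<le> (\<Sum>t=Suc m..n. x t * e t)"
  proof (cases "x m = 0")
    case True
    moreover have "0 \<le> (\<Sum>t=Suc m..n. x t * e t)"
      using count_nonneg idle_nonneg by (intro sum_nonneg mult_nonneg_nonneg)
    ultimately show ?thesis
      using that[of m] \<open>m < n\<close> by simp
  next
    case False
    obtain s where s: "s \<in> {Suc m..n}" and "x s * (\<Sum>t=Suc m..n. e t) \<le> (\<Sum>t=Suc m..n. x t * e t)"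
      using ex_mult_sum_le_weighted_sum[of "{Suc m..n}" e x] idle_nonneg \<open>m < n\<close> by auto
    moreover have "c * x s \<le> x s * (\<Sum>t=Suc m..n. e t)"
      using False off_or_long_window count_nonneg by (subst mult.commute) (intro mult_left_mono, auto)
    ultimately show ?thesis
      using that[of s] by auto
  qed
  have "x n - x s \<le> ?rise s"
    by (rule diff_le_sum_pos_increments[OF \<open>s \<le> n\<close>])
  also have "\<dots> \<le> ?rise m"
    using s by (intro sum_mono2) auto
  finally have "c * (x n - x s) \<le> c * ?rise m"
    using \<open>0 \<le> c\<close> by (rule mult_left_mono)
  then have "c * x n \<le> c * x s + c * ?rise m"
    by (simp add: algebra_simps)
  also have "\<dots> \<le> (\<Sum>t=Suc m..n. x t * e t) + c * ?rise m"
    using run by simp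
  finally show ?thesis
    by (simp add: sum.distrib sum_distrib_left)
qed

lemma sum_sliding_window_le:
  fixes p :: "nat \<Rightarrow> 'a::linordered_semidom"
  assumes "\<And>u. 0 \<le> p u"
  shows "(\<Sum>t=1..n. \<Sum>u=Suc (t - r)..t. p u) \<le> of_nat r * (\<Sum>u=1..n. p u)"
proof -
  have "(\<Sum>t=1..n. \<Sum>u=Suc (t - r)..t. p u)
      = (\<Sum>t=1..n. \<Sum>u | u \<in> {1..n} \<and> u \<le> t \<and> t < u + r. p u)"
    by (intro sum.cong refl) auto
  also have "\<dots> = (\<Sum>u=1..n. \<Sum>t | t \<in> {1..n} \<and> u \<le> t \<and> t < u + r. p u)"
    by (rule sum.swap_restrict) simp_all
  also have "\<dots> \<le> (\<Sum>u=1..n. \<Sum>t=u..<u + r. p u)"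
    using assms by (intro sum_mono sum_mono2) auto
  finally show ?thesis
    by (simp add: sum_distrib_left)
qed


section \<open>Costs of truncated instances\<close>

definition switching_cost :: "dc_instance \<Rightarrow> schedule \<Rightarrow> nat \<Rightarrow> real" where
  "switching_cost I X t = (\<Sum>j=1..num_types I.
     swcost I j * max (real (entry I X t j) - real (entry I X (t - 1) j)) 0)"

definition step_cost :: "dc_instance \<Rightarrow> schedule \<Rightarrow> nat \<Rightarrow> ereal" where
  "step_cost I X t = slot_cost I t (entry I X t) + ereal (switching_cost I X t)"

definition opt_cost :: "dc_instance \<Rightarrow> ereal" where
  "opt_cost I = (INF X\<in>Collect (feasible I). total_cost I X)"

lemma opt_cost_le: "feasible I X \<Longrightarrow> opt_cost I \<le> total_cost I X"
  unfolding opt_cost_def by (rule INF_lower) simp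

lemma total_cost_optimal: "optimal I X \<Longrightarrow> total_cost I X = opt_cost I"
  unfolding opt_cost_def optimal_def by (intro antisym INF_greatest INF_lower) auto

lemma truncated_simps [simp]:
  "horizon (truncated I n) = n" "num_types (truncated I n) = num_types I"
  "servers (truncated I n) = servers I" "swcost (truncated I n) = swcost I"
  "zmax (truncated I n) = zmax I" "volume (truncated I n) = volume I"
  "opcost (truncated I n) = opcost I" "truncated I (horizon I) = I"
  by (simp_all add: truncated_def)

lemma feasible_truncated_antimono:
  "feasible (truncated I n) X \<Longrightarrow> m \<le> n \<Longrightarrow> feasible (truncated I m) X"
  by (auto simp: feasible_def)

lemma slot_cost_truncated: "slot_cost (truncated I n) t x = slot_cost I t x"
proof -
  have "type_cost (truncated I n) t j k z = type_cost I t j k z" for j k z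
    by (simp add: type_cost_def load_cost_def)
  then show ?thesis
    by (simp add: slot_cost_def load_splits_def)
qed

lemma total_cost_truncated:
  assumes "n \<le> horizon I"
  shows "total_cost (truncated I n) X = (\<Sum>t=1..n. step_cost I X t)"
proof -
  have "entry (truncated I n) X t = entry I X t" if "t \<le> n" for t
    using that assms by (auto simp: entry_def fun_eq_iff)
  then show ?thesis
    unfolding total_cost_def step_cost_def switching_cost_def
    by (auto simp: slot_cost_truncated le_diff_conv intro!: sum.cong)
qed

lemma total_cost_eq_sum_step_cost: "total_cost I X = (\<Sum>t=1..horizon I. step_cost I X t)"
  using total_cost_truncated[of "horizon I" I X] by simp

lemma opt_cost_add_step_costs_le:
  assumes feasible: "feasible (truncated I n) X" and "m \<le> n" "n \<le> horizon I"
  shows "opt_cost (truncated I m) + (\<Sum>t=Suc m..n. step_cost I X t) \<le> total_cost (truncated I n) X"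
proof -
  have "opt_cost (truncated I m) \<le> (\<Sum>t=1..m. step_cost I X t)"
    using opt_cost_le[OF feasible_truncated_antimono[OF feasible \<open>m \<le> n\<close>]]
      total_cost_truncated[of m I X] assms by simp
  moreover have "{1..n} = {1..m} \<union> {Suc m..n}"
    using \<open>m \<le> n\<close> by auto
  then have "total_cost (truncated I n) X = (\<Sum>t=1..m. step_cost I X t) + (\<Sum>t=Suc m..n. step_cost I X t)"
    using assms by (simp add: total_cost_truncated sum.union_disjoint)
  ultimately show ?thesis
    by (simp add: add_right_mono)
qed


section \<open>Bounds on the costs of valid instances\<close>

locale valid_dc =
  fixes I :: dc_instance
  assumes valid: "valid_instance I"
begin

abbreviation "slots \<equiv> {1..horizon I}"
abbreviation "types \<equiv> {1..num_types I}"
abbreviation "OPT n \<equiv> opt_cost (truncated I n)"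

lemma swcost_pos: "j \<in> types \<Longrightarrow> 0 < swcost I j"
  and zmax_pos: "j \<in> types \<Longrightarrow> 0 < zmax I j"
  and volume_nonneg: "t \<in> slots \<Longrightarrow> 0 \<le> volume I t"
  using valid by (auto simp: valid_instance_def)

lemma swcost_nonneg: "j \<in> types \<Longrightarrow> 0 \<le> swcost I j"
  using swcost_pos by (simp add: less_imp_le)

lemma opcost_convex: "t \<in> slots \<Longrightarrow> j \<in> types \<Longrightarrow> convex_on {0..zmax I j} (opcost I t j)"
  and opcost_mono: "t \<in> slots \<Longrightarrow> j \<in> types \<Longrightarrow> mono_on {0..zmax I j} (opcost I t j)"
  and opcost_idle_nonneg: "t \<in> slots \<Longrightarrow> j \<in> types \<Longrightarrow> 0 \<le> opcost I t j 0"
  using valid zmax_pos[of j] by (auto simp: valid_instance_def less_imp_le)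

lemma type_cost_ge_idle:
  assumes slot: "t \<in> slots" and type: "j \<in> types" and load_nonneg: "0 \<le> z"
  shows "ereal (real x * opcost I t j 0) \<le> type_cost I t j x z"
proof (cases "x > 0 \<and> volume I t * z / real x \<le> zmax I j")
  case True
  have "0 \<le> volume I t * z / real x"
    using volume_nonneg[OF slot] load_nonneg by simp
  then have "opcost I t j 0 \<le> opcost I t j (volume I t * z / real x)"
    using True zmax_pos[OF type] by (intro mono_onD[OF opcost_mono[OF slot type]]) auto
  then show ?thesis
    using True by (simp add: type_cost_def load_cost_def)
qed (auto simp: type_cost_def load_cost_def)

lemma type_cost_add_servers_le:
  assumes slot: "t \<in> slots" and type: "j \<in> types" and load_nonneg: "0 \<le> z"
  shows "type_cost I t j (x + k) z \<le> type_cost I t j x z + ereal (real k * opcost I t j 0)"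
proof -
  define v where "v = volume I t * z"
  have v_nonneg: "0 \<le> v"
    using volume_nonneg[OF slot] load_nonneg by (simp add: v_def)
  consider (servable) "x > 0" "v / real x \<le> zmax I j" | (unused) "x = 0" "v = 0"
    | (unservable) "type_cost I t j x z = \<infinity>"
    using v_nonneg by (cases "x > 0"; cases "v = 0"; cases "v / real x \<le> zmax I j")
      (auto simp: type_cost_def load_cost_def simp flip: v_def)
  then show ?thesis
  proof cases
    case servable
    have "v / (real x + real k) \<le> v / real x"
      using servable v_nonneg by (intro divide_left_mono) auto
    then have "v / (real x + real k) \<le> zmax I j"
      using servable by simp
    moreover have "(real x + real k) * opcost I t j (v / (real x + real k))
        \<le> real x * opcost I t j (v / real x) + real k * opcost I t j 0"
      using convex_on_perspective_subadd[OF opcost_convex[OF slot type],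
            of "v / real x" 0 "real x" "real k"]
        servable v_nonneg zmax_pos[OF type] by (simp add: divide_inverse_commute flip: mult.assoc)
    ultimately show ?thesis
      using servable by (simp add: type_cost_def load_cost_def flip: v_def)
  next
    case unused
    then show ?thesis
      using zmax_pos[OF type] opcost_idle_nonneg[OF slot type]
      by (simp add: type_cost_def load_cost_def flip: v_def)
  qed simp
qed

lemma slot_cost_ge_idle:
  assumes slot: "t \<in> slots"
  shows "ereal (\<Sum>j\<in>types. real (x j) * opcost I t j 0) \<le> slot_cost I t x"
  unfolding slot_cost_def
proof (rule INF_greatest)
  fix z assume "z \<in> load_splits I"
  then show "ereal (\<Sum>j\<in>types. real (x j) * opcost I t j 0)
      \<le> (\<Sum>j\<in>types. type_cost I t j (x j) (z j))"
    unfolding sum_ereal[symmetric]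
    by (intro sum_mono type_cost_ge_idle[OF slot]) (auto simp: load_splits_def)
qed

lemma slot_cost_add_servers_le:
  assumes slot: "t \<in> slots"
  shows "slot_cost I t (\<lambda>j. x j + k j)
    \<le> slot_cost I t x + ereal (\<Sum>j\<in>types. real (k j) * opcost I t j 0)" (is "_ \<le> _ + ereal ?idle")
proof -
  have "slot_cost I t (\<lambda>j. x j + k j) - ereal ?idle \<le> slot_cost I t x"
    unfolding slot_cost_def[of I t x]
  proof (rule INF_greatest)
    fix z assume load_split: "z \<in> load_splits I"
    have "slot_cost I t (\<lambda>j. x j + k j) \<le> (\<Sum>j\<in>types. type_cost I t j (x j + k j) (z j))"
      unfolding slot_cost_def by (rule INF_lower[OF load_split])
    also have "\<dots> \<le> (\<Sum>j\<in>types. type_cost I t j (x j) (z j) + ereal (real (k j) * opcost I t j 0))"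
      using load_split by (intro sum_mono type_cost_add_servers_le[OF slot]) (auto simp: load_splits_def)
    also have "\<dots> = (\<Sum>j\<in>types. type_cost I t j (x j) (z j)) + ereal ?idle"
      by (simp add: sum.distrib)
    finally show "slot_cost I t (\<lambda>j. x j + k j) - ereal ?idle
        \<le> (\<Sum>j\<in>types. type_cost I t j (x j) (z j))"
      by (simp add: ereal_minus_le)
  qed
  then show ?thesis
    by (simp add: ereal_minus_le)
qed

lemma slot_cost_nonneg:
  assumes "t \<in> slots"
  shows "0 \<le> slot_cost I t x"
proof -
  have "0 \<le> ereal (\<Sum>j\<in>types. real (x j) * opcost I t j 0)"
    using opcost_idle_nonneg[OF assms] by (auto intro!: sum_nonneg)
  also have "\<dots> \<le> slot_cost I t x"
    by (rule slot_cost_ge_idle[OF assms])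
  finally show ?thesis .
qed

lemma switching_cost_nonneg: "0 \<le> switching_cost I X t"
  unfolding switching_cost_def using swcost_nonneg by (intro sum_nonneg mult_nonneg_nonneg) auto

lemma slot_cost_le_step_cost: "slot_cost I t (entry I X t) \<le> step_cost I X t"
  using add_left_mono[of 0 "ereal (switching_cost I X t)"] switching_cost_nonneg
  by (fastforce simp: step_cost_def)

lemma step_cost_nonneg: "t \<in> slots \<Longrightarrow> 0 \<le> step_cost I X t"
  using slot_cost_nonneg slot_cost_le_step_cost order_trans by blast

lemma step_cost_ge_type:
  assumes slot: "t \<in> slots" and type: "j \<in> types"
  shows "ereal (real (entry I X t j) * opcost I t j 0
      + swcost I j * max (real (entry I X t j) - real (entry I X (t - 1) j)) 0) \<le> step_cost I X t"
proof -
  have "real (entry I X t j) * opcost I t j 0 \<le> (\<Sum>j\<in>types. real (entry I X t j) * opcost I t j 0)"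
    using opcost_idle_nonneg[OF slot] by (intro member_le_sum type mult_nonneg_nonneg) auto
  then have "ereal (real (entry I X t j) * opcost I t j 0) \<le> slot_cost I t (entry I X t)"
    using slot_cost_ge_idle[OF slot, of "entry I X t"] order_trans ereal_less_eq(3) by blast
  moreover have "swcost I j * max (real (entry I X t j) - real (entry I X (t - 1) j)) 0
      \<le> switching_cost I X t"
    unfolding switching_cost_def
    using swcost_nonneg by (intro member_le_sum type mult_nonneg_nonneg) auto
  ultimately show ?thesis
    unfolding step_cost_def plus_ereal.simps(1)[symmetric] by (intro add_mono) auto
qed

lemma OPT_nonneg: "n \<le> horizon I \<Longrightarrow> 0 \<le> OPT n"
  unfolding opt_cost_def
  by (auto intro!: INF_greatest sum_nonneg step_cost_nonneg simp: total_cost_truncated)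

lemma OPT_mono:
  assumes "m \<le> n" "n \<le> horizon I"
  shows "OPT m \<le> OPT n"
  unfolding opt_cost_def[of "truncated I n"]
proof (rule INF_greatest)
  fix X assume feasible: "X \<in> Collect (feasible (truncated I n))"
  have "0 \<le> (\<Sum>t=Suc m..n. step_cost I X t)"
    using assms by (intro sum_nonneg step_cost_nonneg) auto
  then have "OPT m \<le> OPT m + (\<Sum>t=Suc m..n. step_cost I X t)"
    by (metis add.right_neutral add_left_mono)
  also have "\<dots> \<le> total_cost (truncated I n) X"
    using feasible assms by (intro opt_cost_add_step_costs_le) auto
  finally show "OPT m \<le> total_cost (truncated I n) X" .
qed

lemma sum_slot_cost_le_OPT:
  assumes "\<And>t. t \<in> slots \<Longrightarrow> optimal (truncated I t) (Xh t)"
  shows "n \<le> horizon I \<Longrightarrow> (\<Sum>t=1..n. slot_cost I t (Xh t t)) \<le> OPT n"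
proof (induction n)
  case 0
  then show ?case by (simp add: OPT_nonneg)
next
  case (Suc n)
  have Xh_Suc: "optimal (truncated I (Suc n)) (Xh (Suc n))"
    using assms Suc by simp
  have "entry I (Xh (Suc n)) (Suc n) = Xh (Suc n) (Suc n)"
    using Suc by (auto simp: entry_def fun_eq_iff)
  then have "(\<Sum>t=1..Suc n. slot_cost I t (Xh t t)) \<le> OPT n + step_cost I (Xh (Suc n)) (Suc n)"
    using Suc slot_cost_le_step_cost[of "Suc n" "Xh (Suc n)"] by (auto intro!: add_mono)
  also have "\<dots> \<le> total_cost (truncated I (Suc n)) (Xh (Suc n))"
    using opt_cost_add_step_costs_le[of I "Suc n" "Xh (Suc n)" n] Xh_Suc Suc by (simp add: optimal_def)
  also have "\<dots> = OPT (Suc n)"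
    by (rule total_cost_optimal[OF Xh_Suc])
  finally show ?case .
qed

lemma OPT_add_swcost_le_total_cost:
  assumes type: "j \<in> types" and feasible: "feasible (truncated I n) X" and prefix: "m < n" "n \<le> horizon I"
    and window: "m = 0 \<or> swcost I j \<le> (\<Sum>t=Suc m..n. opcost I t j 0)"
  shows "OPT m + ereal (swcost I j * real (X n j)) \<le> total_cost (truncated I n) X"
proof -
  let ?x = "\<lambda>t. real (entry I X t j)"
  have "swcost I j * ?x n
      \<le> (\<Sum>t=Suc m..n. ?x t * opcost I t j 0 + swcost I j * max (?x t - ?x (t - 1)) 0)"
    using prefix type window opcost_idle_nonneg swcost_nonneg
    by (intro power_up_or_run_cost_ge) (auto simp: entry_def)
  also have "ereal \<dots> \<le> (\<Sum>t=Suc m..n. step_cost I X t)"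
    unfolding sum_ereal[symmetric] using prefix by (intro sum_mono step_cost_ge_type type) auto
  finally have "OPT m + ereal (swcost I j * ?x n) \<le> OPT m + (\<Sum>t=Suc m..n. step_cost I X t)"
    by (intro add_left_mono) simp
  also have "\<dots> \<le> total_cost (truncated I n) X"
    using prefix by (intro opt_cost_add_step_costs_le feasible) auto
  finally show ?thesis
    using prefix by (simp add: entry_def)
qed

end


section \<open>The schedule of the algorithm\<close>

definition powered_up ::
  "dc_instance \<Rightarrow> (nat \<Rightarrow> real \<Rightarrow> real) \<Rightarrow> (nat \<Rightarrow> schedule) \<Rightarrow> nat \<Rightarrow> nat \<Rightarrow> nat" where
  "powered_up I f Xh t j = snd (alg_state I f Xh t) (int t) j"

definition kept_running ::
  "dc_instance \<Rightarrow> (nat \<Rightarrow> real \<Rightarrow> real) \<Rightarrow> (nat \<Rightarrow> schedule) \<Rightarrow> nat \<Rightarrow> nat \<Rightarrow> nat" where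
  "kept_running I f Xh n j =
     alg_schedule I f Xh n j - snd (alg_state I f Xh n) (int (Suc n) - int (run_time I f j)) j"

lemma alg_schedule_0: "alg_schedule I f Xh 0 j = 0"
  by (simp add: alg_schedule_def)

lemma alg_schedule_Suc:
  "alg_schedule I f Xh (Suc n) j = max (Xh (Suc n) (Suc n) j) (kept_running I f Xh n j)"
  by (simp add: alg_schedule_def kept_running_def Let_def max_def split: prod.splits)

lemma powered_up_Suc:
  "powered_up I f Xh (Suc n) j = Xh (Suc n) (Suc n) j - kept_running I f Xh n j"
  using alg_w_outside[of "int (Suc n)" n I f Xh j]
  by (auto simp: powered_up_def alg_schedule_def kept_running_def Let_def split: prod.splits)

lemma alg_schedule_ge: "t \<ge> 1 \<Longrightarrow> Xh t t j \<le> alg_schedule I f Xh t j"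
  by (cases t) (simp_all add: alg_schedule_Suc)

lemma powered_up_le: "t \<ge> 1 \<Longrightarrow> powered_up I f Xh t j \<le> Xh t t j"
  by (cases t) (simp_all add: powered_up_Suc)

lemma alg_schedule_eq_if_powered_up:
  "t \<ge> 1 \<Longrightarrow> powered_up I f Xh t j > 0 \<Longrightarrow> alg_schedule I f Xh t j = Xh t t j"
  by (cases t) (simp_all add: powered_up_Suc alg_schedule_Suc)

lemma alg_schedule_le_add_powered_up:
  assumes "t \<ge> 1"
  shows "alg_schedule I f Xh t j \<le> alg_schedule I f Xh (t - 1) j + powered_up I f Xh t j"
proof -
  obtain n where "t = Suc n"
    using assms by (cases t) auto
  moreover have "kept_running I f Xh n j \<le> alg_schedule I f Xh n j"
    by (simp add: kept_running_def)
  ultimately show ?thesis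
    by (simp add: alg_schedule_Suc powered_up_Suc)
qed

lemma alg_w_eq_powered_up:
  "u \<le> int t \<Longrightarrow> snd (alg_state I f Xh t) u j = powered_up I f Xh (nat u) j"
proof (induction t)
  case 0
  then show ?case
    by (simp add: powered_up_def)
next
  case (Suc t)
  then show ?case
    by (cases "u = int (Suc t)") (auto simp: powered_up_def Let_def nat_add_distrib split: prod.splits)
qed

lemma alg_schedule_eq_sum_powered_up:
  assumes "run_time I f j \<ge> 1"
  shows "alg_schedule I f Xh t j = (\<Sum>u=Suc (t - run_time I f j)..t. powered_up I f Xh u j)"
proof -
  let ?window = "{int t - int (run_time I f j)<..int t}"
  have "alg_schedule I f Xh t j = (\<Sum>u\<in>?window. snd (alg_state I f Xh t) u j)"
    unfolding alg_schedule_def by (rule alg_x_eq_sum[OF assms])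
  also have "\<dots> = (\<Sum>u=Suc (t - run_time I f j)..t. powered_up I f Xh u j)"
    by (rule sum.reindex_bij_witness_not_neutral[where S' = "?window \<inter> {..0}" and T' = "{}"
          and i = int and j = nat])
      (auto simp: alg_w_outside alg_w_eq_powered_up)
  finally show ?thesis .
qed

lemma sum_powered_up_if_powered_up:
  assumes "run_time I f j \<ge> 1" "n \<ge> 1" "powered_up I f Xh n j > 0"
  shows "(\<Sum>u=1..n. powered_up I f Xh u j)
    = (\<Sum>u=1..n - run_time I f j. powered_up I f Xh u j) + Xh n n j"
proof -
  let ?m = "n - run_time I f j"
  have "{1..n} = {1..?m} \<union> {Suc ?m..n}"
    using assms by auto
  then have "(\<Sum>u=1..n. powered_up I f Xh u j)
      = (\<Sum>u=1..?m. powered_up I f Xh u j) + (\<Sum>u=Suc ?m..n. powered_up I f Xh u j)"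
    by (simp add: sum.union_disjoint)
  also have "(\<Sum>u=Suc ?m..n. powered_up I f Xh u j) = alg_schedule I f Xh n j"
    by (rule alg_schedule_eq_sum_powered_up[OF assms(1), symmetric])
  also have "\<dots> = Xh n n j"
    by (rule alg_schedule_eq_if_powered_up[OF assms(2,3)])
  finally show ?thesis .
qed


section \<open>Competitiveness\<close>

locale time_independent_dc = valid_dc +
  fixes f :: "nat \<Rightarrow> real \<Rightarrow> real"
  assumes opcost_eq: "\<And>t j z. t \<in> slots \<Longrightarrow> j \<in> types \<Longrightarrow> z \<in> {0..zmax I j} \<Longrightarrow> opcost I t j z = f j z"
    and idle_pos: "\<And>j. j \<in> types \<Longrightarrow> 0 < f j 0"
begin

lemma opcost_idle_eq: "t \<in> slots \<Longrightarrow> j \<in> types \<Longrightarrow> opcost I t j 0 = f j 0"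
  using zmax_pos[of j] by (intro opcost_eq) auto

lemma run_time_ge_1: "j \<in> types \<Longrightarrow> run_time I f j \<ge> 1"
  using swcost_pos[of j] idle_pos[of j] by (simp add: run_time_def Suc_le_eq)

lemma swcost_le_run_time_idle:
  assumes "j \<in> types"
  shows "swcost I j \<le> real (run_time I f j) * f j 0"
proof -
  have "swcost I j / f j 0 \<le> real (run_time I f j)"
    unfolding run_time_def by linarith
  then show ?thesis
    using idle_pos[OF assms] by (simp add: field_simps)
qed

lemma run_time_idle_le_swcost:
  assumes "j \<in> types"
  shows "(real (run_time I f j) - 1) * f j 0 \<le> swcost I j"
proof -
  have "0 < swcost I j / f j 0"
    using swcost_pos idle_pos assms by simp
  then have "real (run_time I f j) - 1 \<le> swcost I j / f j 0"
    unfolding run_time_def by linarith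
  then show ?thesis
    using idle_pos[OF assms] by (simp add: field_simps)
qed

end

locale online_dc = time_independent_dc +
  fixes Xh :: "nat \<Rightarrow> schedule"
  assumes Xh_optimal: "\<And>t. t \<in> slots \<Longrightarrow> optimal (truncated I t) (Xh t)"
begin

abbreviation "alg \<equiv> alg_schedule I f Xh"
abbreviation "ups \<equiv> powered_up I f Xh"

definition overhead :: "nat \<Rightarrow> nat \<Rightarrow> real" where
  "overhead t j = real (alg t j - Xh t t j) * f j 0 + swcost I j * real (ups t j)"

lemma OPT_add_swcost_le_OPT:
  assumes type: "j \<in> types" and slot: "n \<in> slots"
  shows "OPT (n - run_time I f j) + ereal (swcost I j * real (Xh n n j)) \<le> OPT n"
proof -
  let ?m = "n - run_time I f j"
  have window: "?m = 0 \<or> swcost I j \<le> (\<Sum>t=Suc ?m..n. opcost I t j 0)"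
  proof (cases "?m = 0")
    case False
    have "(\<Sum>t=Suc ?m..n. opcost I t j 0) = (\<Sum>t=Suc ?m..n. f j 0)"
      using slot by (intro sum.cong refl opcost_idle_eq type) auto
    then show ?thesis
      using False swcost_le_run_time_idle[OF type] by simp
  qed simp
  have "feasible (truncated I n) (Xh n)"
    using Xh_optimal[OF slot] by (simp add: optimal_def)
  moreover have "?m < n" "n \<le> horizon I"
    using slot run_time_ge_1[OF type] by auto
  ultimately have "OPT ?m + ereal (swcost I j * real (Xh n n j)) \<le> total_cost (truncated I n) (Xh n)"
    using window by (rule OPT_add_swcost_le_total_cost[OF type])
  then show ?thesis
    by (simp only: total_cost_optimal[OF Xh_optimal[OF slot]])
qed

lemma swcost_powered_up_le_OPT:
  assumes type: "j \<in> types"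
  shows "n \<le> horizon I \<Longrightarrow> ereal (swcost I j * real (\<Sum>u=1..n. ups u j)) \<le> OPT n"
proof (induction n rule: less_induct)
  case (less n)
  consider (start) "n = 0" | (idle) "n \<in> slots" "ups n j = 0" | (power_up) "n \<in> slots" "0 < ups n j"
    using less.prems by fastforce
  then show ?case
  proof cases
    case start
    then show ?thesis using OPT_nonneg[of 0] by (simp flip: zero_ereal_def)
  next
    case idle
    then have "(\<Sum>u=1..n. ups u j) = (\<Sum>u=1..n - 1. ups u j)"
      by (cases n) auto
    then have "ereal (swcost I j * real (\<Sum>u=1..n. ups u j)) \<le> OPT (n - 1)"
      using less idle by simp
    also have "\<dots> \<le> OPT n"
      using less.prems by (intro OPT_mono) auto
    finally show ?thesis .
  next
    case power_up
    define m where "m = n - run_time I f j"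
    have "m < n"
      using power_up run_time_ge_1[OF type] by (simp add: m_def)
    have "(\<Sum>u=1..n. ups u j) = (\<Sum>u=1..m. ups u j) + Xh n n j"
      unfolding m_def using power_up by (intro sum_powered_up_if_powered_up run_time_ge_1 type) auto
    then have "ereal (swcost I j * real (\<Sum>u=1..n. ups u j))
        = ereal (swcost I j * real (\<Sum>u=1..m. ups u j)) + ereal (swcost I j * real (Xh n n j))"
      by (simp add: algebra_simps)
    also have "\<dots> \<le> OPT m + ereal (swcost I j * real (Xh n n j))"
      using less \<open>m < n\<close> by (intro add_right_mono) auto
    also have "\<dots> \<le> OPT n"
      unfolding m_def by (rule OPT_add_swcost_le_OPT[OF type power_up(1)])
    finally show ?thesis .
  qed
qed

lemma sum_surplus_le:
  assumes type: "j \<in> types"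
  shows "(\<Sum>t=1..n. real (alg t j - Xh t t j))
    \<le> (real (run_time I f j) - 1) * real (\<Sum>u=1..n. ups u j)"
proof -
  have "(\<Sum>t=1..n. real (alg t j - Xh t t j)) \<le> (\<Sum>t=1..n. real (alg t j) - real (ups t j))"
  proof (rule sum_mono)
    fix t assume "t \<in> {1..n}"
    then show "real (alg t j - Xh t t j) \<le> real (alg t j) - real (ups t j)"
      using powered_up_le[of t I f Xh j] alg_schedule_ge[of t Xh j I f] by simp
  qed
  also have "\<dots> = real (\<Sum>t=1..n. alg t j) - real (\<Sum>u=1..n. ups u j)"
    by (simp add: sum_subtractf)
  also have "\<dots> \<le> real (run_time I f j * (\<Sum>u=1..n. ups u j)) - real (\<Sum>u=1..n. ups u j)"
    using sum_sliding_window_le[of "\<lambda>u. ups u j" "run_time I f j" n]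
    unfolding alg_schedule_eq_sum_powered_up[OF run_time_ge_1[OF type]]
    by (intro diff_right_mono of_nat_mono) simp
  finally show ?thesis
    by (simp add: algebra_simps)
qed

lemma sum_overhead_le_OPT:
  assumes type: "j \<in> types" and slot_bound: "n \<le> horizon I"
  shows "ereal (\<Sum>t=1..n. overhead t j) \<le> 2 * OPT n"
proof -
  let ?ups = "real (\<Sum>u=1..n. ups u j)"
  have "(\<Sum>t=1..n. overhead t j) = (\<Sum>t=1..n. real (alg t j - Xh t t j)) * f j 0 + swcost I j * ?ups"
    by (simp add: overhead_def sum.distrib sum_distrib_left sum_distrib_right)
  also have "\<dots> \<le> (real (run_time I f j) - 1) * ?ups * f j 0 + swcost I j * ?ups"
    using idle_pos[OF type] by (intro add_right_mono mult_right_mono sum_surplus_le type) simp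
  also have "\<dots> = ((real (run_time I f j) - 1) * f j 0) * ?ups + swcost I j * ?ups"
    by simp
  also have "\<dots> \<le> swcost I j * ?ups + swcost I j * ?ups"
    by (intro add_right_mono mult_right_mono run_time_idle_le_swcost type of_nat_0_le_iff)
  finally have "ereal (\<Sum>t=1..n. overhead t j) \<le> 2 * ereal (swcost I j * ?ups)"
    by (simp add: numeral_eq_ereal del: of_nat_sum)
  also have "\<dots> \<le> 2 * OPT n"
    using swcost_powered_up_le_OPT[OF type slot_bound] by (intro ereal_mult_left_mono) auto
  finally show ?thesis .
qed

lemma step_cost_alg_le:
  assumes slot: "t \<in> slots"
  shows "step_cost I alg t \<le> slot_cost I t (Xh t t) + ereal (\<Sum>j\<in>types. overhead t j)"
proof -
  have entry_alg: "entry I alg s = alg s" if "s \<le> t" for s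
    using that slot by (auto simp: entry_def fun_eq_iff alg_schedule_0 not_less_eq_eq)
  have "alg t = (\<lambda>j. Xh t t j + (alg t j - Xh t t j))"
    using slot by (simp add: alg_schedule_ge fun_eq_iff)
  then have "slot_cost I t (alg t)
      \<le> slot_cost I t (Xh t t) + ereal (\<Sum>j\<in>types. real (alg t j - Xh t t j) * opcost I t j 0)"
    using slot_cost_add_servers_le[OF slot, of "Xh t t" "\<lambda>j. alg t j - Xh t t j"] by simp
  moreover have "switching_cost I alg t \<le> (\<Sum>j\<in>types. swcost I j * real (ups t j))"
    unfolding switching_cost_def entry_alg[OF order_refl] entry_alg[OF diff_le_self]
  proof (intro sum_mono mult_left_mono swcost_nonneg)
    fix j
    show "max (real (alg t j) - real (alg (t - 1) j)) 0 \<le> real (ups t j)"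
      using alg_schedule_le_add_powered_up[of t I f Xh j] slot by auto
  qed
  ultimately have "step_cost I alg t
      \<le> (slot_cost I t (Xh t t) + ereal (\<Sum>j\<in>types. real (alg t j - Xh t t j) * opcost I t j 0))
        + ereal (\<Sum>j\<in>types. swcost I j * real (ups t j))"
    unfolding step_cost_def entry_alg[OF order_refl] by (intro add_mono) auto
  then show ?thesis
    by (simp add: overhead_def opcost_idle_eq[OF slot] sum.distrib add.assoc)
qed

lemma total_cost_alg_le:
  "total_cost I alg \<le> (\<Sum>t\<in>slots. slot_cost I t (Xh t t))
     + (\<Sum>j\<in>types. ereal (\<Sum>t\<in>slots. overhead t j))"
proof -
  have "total_cost I alg \<le> (\<Sum>t\<in>slots. slot_cost I t (Xh t t) + ereal (\<Sum>j\<in>types. overhead t j))"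
    unfolding total_cost_eq_sum_step_cost by (intro sum_mono step_cost_alg_le)
  also have "\<dots> = (\<Sum>t\<in>slots. slot_cost I t (Xh t t)) + ereal (\<Sum>t\<in>slots. \<Sum>j\<in>types. overhead t j)"
    by (simp add: sum.distrib)
  finally show ?thesis
    by (subst (asm) sum.swap) simp
qed

end

theorem theorem8:
  fixes I :: dc_instance
    and f :: "nat \<Rightarrow> real \<Rightarrow> real"
    and Xh :: "nat \<Rightarrow> schedule"
    and Xopt :: schedule
  assumes "valid_instance I"
    and "\<And>t j z. t \<in> {1..horizon I} \<Longrightarrow> j \<in> {1..num_types I} \<Longrightarrow> z \<in> {0..zmax I j} \<Longrightarrow>
           opcost I t j z = f j z"
    and "\<And>j. j \<in> {1..num_types I} \<Longrightarrow> f j 0 > 0"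
    and "\<And>t. t \<in> {1..horizon I} \<Longrightarrow> optimal (truncated I t) (Xh t)"
    and "optimal I Xopt"
  shows "total_cost I (alg_schedule I f Xh)
         \<le> ereal (2 * real (num_types I) + 1) * total_cost I Xopt"
proof -
  interpret online_dc I f Xh
    using assms by unfold_locales auto
  let ?T = "horizon I"
  have "total_cost I alg
      \<le> (\<Sum>t\<in>slots. slot_cost I t (Xh t t)) + (\<Sum>j\<in>types. ereal (\<Sum>t\<in>slots. overhead t j))"
    by (rule total_cost_alg_le)
  also have "\<dots> \<le> OPT ?T + (\<Sum>j\<in>types. 2 * OPT ?T)"
    by (intro add_mono sum_mono sum_slot_cost_le_OPT sum_overhead_le_OPT Xh_optimal order_refl)
  also have "\<dots> = ereal (2 * real (num_types I) + 1) * OPT ?T"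
    using OPT_nonneg[of ?T] by (cases "OPT ?T") (auto simp: algebra_simps)
  also have "OPT ?T = total_cost I Xopt"
    using total_cost_optimal[OF assms(5)] by simp
  finally show ?thesis .
qed

end
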